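(* Let $n\ge 2$. View the function $S=-\sum_{i=1}^n x_i\log x_i$ of $n$ variables $x_1,\dots,x_n>0$ as a function of the elementary symmetric polynomials $s_1,\dots,s_n$ of $x_1,\dots,x_n$; that is, near any point $(x_1,\dots,x_n)$ with pairwise distinct positive entries, use $(s_1,\dots,s_n)$ as local coordinates in place of $(x_1,\dots,x_n)$. Then at every such point $$\frac{\partial S}{\partial s_q}>0\qquad\text{for all } q=2,\dots,n,$$ where the partial derivative is taken with all $s_j$, $j\ne q$, held fixed.
   Context: The elementary symmetric polynomials are $s_i=\sum_{1\le u_1<\dots<u_i\le n}x_{u_1}\cdots x_{u_i}$ for $i=1,\dots,n$. The normalization $\sum_i x_i=1$ (i.e. $s_1=1$) is lifted, so that both $(x_1,\dots,x_n)$ and $(s_1,\dots,s_n)$ are sets of $n$ independent variables. The Jacobian of $(x_1,\dots,x_n)\mapsto(s_1,\dots,s_n)$ equals, up to sign, $\prod_{i<j}(x_i-x_j)$, so near a point with pairwise distinct $x_i$ this map is a local diffeomorphism, and $S$ becomes a smooth function of $(s_1,\dots,s_n)$ near the image point. $\log$ denotes the natural logarithm. *)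

theory Defs
  imports "HOL-Analysis.Analysis"
begin

definition esym :: "nat \<Rightarrow> real ^ 'n \<Rightarrow> real" where
  "esym k x = (\<Sum>K | card K = k. \<Prod>i\<in>K. x $ i)"

text \<open>
  The index type carries no numbering of its own. A bijection \<open>idx\<close> from \<open>'n\<close> onto
  \<open>{1..CARD('n)}\<close> says which elementary symmetric polynomial occupies which coordinate
  of the target space.
\<close>
definition esym_map :: "('n \<Rightarrow> nat) \<Rightarrow> real ^ 'n \<Rightarrow> real ^ 'n" where
  "esym_map idx x = (\<chi> j. esym (idx j) x)"

definition entropy :: "real ^ 'n \<Rightarrow> real" where
  "entropy x = - (\<Sum>i\<in>UNIV. x $ i * ln (x $ i))"

text \<open>
  \<open>Ck_on k f U\<close> is meant for open \<open>U\<close> only: the derivative is the unrestricted one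
  at each point of \<open>U\<close>.
\<close>
primrec Ck_on :: "nat \<Rightarrow> ('a::real_normed_vector \<Rightarrow> 'b::real_normed_vector) \<Rightarrow> 'a set \<Rightarrow> bool" where
  "Ck_on 0 f U \<longleftrightarrow> continuous_on U f"
| "Ck_on (Suc k) f U \<longleftrightarrow>
     (\<forall>x\<in>U. f differentiable (at x)) \<and> (\<forall>v. Ck_on k (\<lambda>x. frechet_derivative f (at x) v) U)"

definition smooth_on :: "('a::real_normed_vector \<Rightarrow> 'b::real_normed_vector) \<Rightarrow> 'a set \<Rightarrow> bool" where
  "smooth_on f U \<longleftrightarrow> (\<forall>k. Ck_on k f U)"

text \<open>
  \<open>f\<close> restricts to a diffeomorphism from the neighbourhood \<open>U\<close> of \<open>x\<close> onto \<open>V\<close>, with inverse \<open>g\<close>.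
\<close>
definition local_diffeo_at ::
  "('a::real_normed_vector \<Rightarrow> 'b::real_normed_vector) \<Rightarrow> 'a \<Rightarrow> 'a set \<Rightarrow> 'b set \<Rightarrow> ('b \<Rightarrow> 'a) \<Rightarrow> bool" where
  "local_diffeo_at f x U V g \<longleftrightarrow>
     open U \<and> x \<in> U \<and> open V \<and> homeomorphism U V f g \<and> smooth_on f U \<and> smooth_on g V"

end

theory Submission
  imports Defs "HOL-Computational_Algebra.Polynomial"
begin

text \<open>
  Differentiating \<open>\<Prod>j. (t - x\<^sub>j) = \<Sum>k. (-1)\<^sup>k s\<^sub>k t\<^sup>n\<^sup>-\<^sup>k\<close> and putting \<open>t = x\<^sub>i\<close> inverts the Jacobian
  explicitly: \<open>\<partial>x\<^sub>i/\<partial>s\<^sub>q = (-1)\<^sup>q\<^sup>-\<^sup>1 x\<^sub>i\<^sup>n\<^sup>-\<^sup>q / \<Prod>j\<noteq>i. (x\<^sub>i - x\<^sub>j)\<close>. Hence \<open>\<partial>S/\<partial>s\<^sub>q\<close> is \<open>(-1)\<^sup>q\<close> times the divided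
  difference of \<open>f(t) = t\<^sup>n\<^sup>-\<^sup>q (ln t + 1)\<close> at \<open>x\<^sub>1, \<dots>, x\<^sub>n\<close>. By iterated Rolle, applied to \<open>f\<close> minus its
  Lagrange interpolation polynomial, this divided difference is a value of \<open>f\<^sup>(\<^sup>n\<^sup>-\<^sup>1\<^sup>)\<close> divided by \<open>(n-1)!\<close>,
  and \<open>f\<^sup>(\<^sup>n\<^sup>-\<^sup>1\<^sup>)\<close> has sign \<open>(-1)\<^sup>q\<close> on the positive reals.

  The same formula gives the smoothness of a local inverse \<open>g\<close>: the directional derivatives of its
  components, and of the functions \<open>1/(g\<^sub>i - g\<^sub>k)\<close>, lie in the algebra generated by these functions, and
  an algebra of functions closed under differentiation consists of smooth functions.
\<close>

section \<open>Iterated derivatives on the positive half-line\<close>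

text \<open>A relation rather than an iterated \<open>deriv\<close>: every intermediate derivative
  is a witness constrained at positive points only. Differentiability is thus recorded at each
  stage, and the values of \<open>ln\<close> and \<open>inverse\<close> elsewhere never
  matter.\<close>

primrec higher_deriv_pos :: "nat \<Rightarrow> (real \<Rightarrow> real) \<Rightarrow> (real \<Rightarrow> real) \<Rightarrow> bool" where
  "higher_deriv_pos 0 f g \<longleftrightarrow> (\<forall>x>0. f x = g x)"
| "higher_deriv_pos (Suc k) f g \<longleftrightarrow>
     (\<exists>f'. (\<forall>x>0. (f has_real_derivative f' x) (at x)) \<and> higher_deriv_pos k f' g)"

lemma higher_deriv_pos_SucI:
  assumes "\<And>x. x > 0 \<Longrightarrow> (f has_real_derivative f' x) (at x)" "higher_deriv_pos k f' g"
  shows "higher_deriv_pos (Suc k) f g"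
  using assms by auto

lemma higher_deriv_pos_add:
  assumes "higher_deriv_pos k f1 g1" "higher_deriv_pos k f2 g2"
  shows "higher_deriv_pos k (\<lambda>x. f1 x + f2 x) (\<lambda>x. g1 x + g2 x)"
  using assms
proof (induction k arbitrary: f1 f2)
  case (Suc k)
  then obtain f1' f2' where "\<forall>x>0. (f1 has_real_derivative f1' x) (at x)"
    "\<forall>x>0. (f2 has_real_derivative f2' x) (at x)"
    "higher_deriv_pos k f1' g1" "higher_deriv_pos k f2' g2"
    by auto
  then show ?case
    using Suc.IH by (auto intro!: exI[of _ "\<lambda>x. f1' x + f2' x"] derivative_eq_intros)
qed auto

lemma higher_deriv_pos_cmult:
  assumes "higher_deriv_pos k f g"
  shows "higher_deriv_pos k (\<lambda>x. c * f x) (\<lambda>x. c * g x)"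
  using assms
proof (induction k arbitrary: f)
  case (Suc k)
  then obtain f' where "\<forall>x>0. (f has_real_derivative f' x) (at x)" "higher_deriv_pos k f' g"
    by auto
  then show ?case
    using Suc.IH by (auto intro!: exI[of _ "\<lambda>x. c * f' x"] derivative_eq_intros)
qed auto

text \<open>For degree below \<open>k\<close> the constant is zero, which removes lower powers; for
  the interpolation polynomial it extracts the leading coefficient.\<close>

lemma higher_deriv_pos_poly:
  assumes "degree p \<le> k"
  shows "higher_deriv_pos k (poly p) (\<lambda>_. fact k * coeff p k)"
  using assms
proof (induction k arbitrary: p)
  case 0
  then show ?case by (auto elim!: degree_eq_zeroE)
next
  case (Suc k)
  have "degree (pderiv p) \<le> k"
    using Suc.prems by (simp add: degree_pderiv)
  from Suc.IH[OF this] have "higher_deriv_pos k (poly (pderiv p)) (\<lambda>_. fact (Suc k) * coeff p (Suc k))"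
    by (simp add: coeff_pderiv algebra_simps)
  then show ?case
    by (rule higher_deriv_pos_SucI[OF poly_DERIV])
qed

lemma higher_deriv_pos_power_zero:
  assumes "m < k"
  shows "higher_deriv_pos k (\<lambda>x. x ^ m) (\<lambda>_. 0)"
proof -
  have "higher_deriv_pos k (poly (monom 1 m)) (\<lambda>_. 0)"
    using higher_deriv_pos_poly[of "monom 1 m" k] assms by (simp add: degree_monom_eq)
  moreover have "poly (monom 1 m) = (\<lambda>x :: real. x ^ m)"
    by (simp add: fun_eq_iff poly_monom)
  ultimately show ?thesis by simp
qed

text \<open>Each differentiation raises the exponent by one and multiplies by a negative constant,
  hence one sign change per step and an induction with \<open>j\<close> arbitrary.\<close>

lemma higher_deriv_pos_inverse_power:
  "\<exists>g. higher_deriv_pos k (\<lambda>x. inverse x ^ Suc j) g \<and> (\<forall>x>0. (- 1) ^ k * g x > 0)"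
proof (induction k arbitrary: j)
  case 0
  show ?case by (auto intro!: exI[of _ "\<lambda>x. inverse x ^ Suc j"])
next
  case (Suc k)
  obtain g where g: "higher_deriv_pos k (\<lambda>x. inverse x ^ Suc (Suc j)) g"
    "\<And>x. x > 0 \<Longrightarrow> (- 1) ^ k * g x > 0"
    using Suc by blast
  have "((\<lambda>x. inverse x ^ Suc j) has_real_derivative - real (Suc j) * inverse x ^ Suc (Suc j)) (at x)"
    if "x > 0" for x :: real
    using that DERIV_power[OF DERIV_inverse, of x "Suc j" UNIV] by (simp add: algebra_simps)
  moreover have "higher_deriv_pos k (\<lambda>x. - real (Suc j) * inverse x ^ Suc (Suc j)) (\<lambda>x. - real (Suc j) * g x)"
    by (rule higher_deriv_pos_cmult[OF g(1)])
  ultimately have "higher_deriv_pos (Suc k) (\<lambda>x. inverse x ^ Suc j) (\<lambda>x. - real (Suc j) * g x)"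
    by (rule higher_deriv_pos_SucI)
  moreover have "(- 1) ^ Suc k * (- real (Suc j) * g x) > 0" if "x > 0" for x
  proof -
    have "real (Suc j) * ((- 1) ^ k * g x) > 0"
      using g(2)[OF that] by (rule mult_pos_pos[rotated]) simp
    then show ?thesis by (simp add: algebra_simps)
  qed
  ultimately show ?case by (intro exI[of _ "\<lambda>x. - real (Suc j) * g x"] conjI allI impI)
qed

text \<open>One differentiation gives a positive multiple of the function for the next lower power
  plus a pure power, and the latter is killed by the remaining derivatives. After \<open>m\<close>
  such steps \<open>ln x + 1\<close> is left; it becomes \<open>inverse x\<close>, and only the last
  \<open>k\<close> derivatives change the sign.\<close>

lemma higher_deriv_pos_power_ln:
  "\<exists>g. higher_deriv_pos (Suc (m + k)) (\<lambda>x. x ^ m * (ln x + 1)) g \<and> (\<forall>x>0. (- 1) ^ k * g x > 0)"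
proof (induction m)
  case 0
  obtain g where g: "higher_deriv_pos k (\<lambda>x. inverse x ^ Suc 0) g" "\<forall>x>0. (- 1) ^ k * g x > 0"
    using higher_deriv_pos_inverse_power by blast
  have "((\<lambda>x. ln x + 1) has_real_derivative inverse x ^ Suc 0) (at x)" if "x > 0" for x :: real
    using that by (auto intro!: derivative_eq_intros simp: divide_inverse)
  then have "higher_deriv_pos (Suc k) (\<lambda>x. ln x + 1) g"
    using g(1) by (rule higher_deriv_pos_SucI)
  then show ?case
    using g(2) unfolding power_0 mult_1 add_0 by (intro exI[of _ g] conjI)
next
  case (Suc m)
  then obtain g where g: "higher_deriv_pos (Suc (m + k)) (\<lambda>x. x ^ m * (ln x + 1)) g"
    "\<And>x. x > 0 \<Longrightarrow> (- 1) ^ k * g x > 0" by blast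
  have "((\<lambda>x. x ^ Suc m * (ln x + 1)) has_real_derivative
      real (Suc m) * (x ^ m * (ln x + 1)) + x ^ m) (at x)" if "x > 0" for x :: real
    by (rule derivative_eq_intros refl that)+ (use that in \<open>simp add: field_simps\<close>)
  moreover have "higher_deriv_pos (Suc (m + k)) (\<lambda>x. real (Suc m) * (x ^ m * (ln x + 1)) + x ^ m)
      (\<lambda>x. real (Suc m) * g x + 0)"
    by (intro higher_deriv_pos_add higher_deriv_pos_cmult g(1) higher_deriv_pos_power_zero) simp
  ultimately have "higher_deriv_pos (Suc (Suc m + k)) (\<lambda>x. x ^ Suc m * (ln x + 1))
      (\<lambda>x. real (Suc m) * g x + 0)"
    unfolding add_Suc by (rule higher_deriv_pos_SucI)
  moreover have "(- 1) ^ k * (real (Suc m) * g x + 0) > 0" if "x > 0" for x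
  proof -
    have "real (Suc m) * ((- 1) ^ k * g x) > 0"
      using g(2)[OF that] by (rule mult_pos_pos[rotated]) simp
    then show ?thesis by (simp add: algebra_simps)
  qed
  ultimately show ?case by (intro exI[of _ "\<lambda>x. real (Suc m) * g x + 0"] conjI allI impI)
qed

section \<open>Counting zeros by Rolle's theorem\<close>

text \<open>The points are added in increasing order, each new maximum contributing a zero of
  \<open>f'\<close> between it and the old maximum. The bound \<open>Max A\<close> in the conclusion
  keeps this zero distinct from those found before.\<close>

lemma Rolle_zeros:
  fixes f f' :: "real \<Rightarrow> real"
  assumes "finite A" "A \<noteq> {}" "A \<subseteq> {0<..}" "\<forall>x\<in>A. f x = 0"
    and df: "\<forall>x>0. (f has_real_derivative f' x) (at x)"
  shows "\<exists>B. finite B \<and> B \<subseteq> {0<..<Max A} \<and> (\<forall>x\<in>B. f' x = 0) \<and> Suc (card B) = card A"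
  using assms(1-4)
proof (induction A rule: finite_linorder_max_induct)
  case (insert b A)
  show ?case
  proof (cases "A = {}")
    case False
    then obtain B where B: "finite B" "B \<subseteq> {0<..<Max A}" "\<forall>x\<in>B. f' x = 0" "Suc (card B) = card A"
      using insert by auto
    have M: "Max A \<in> A" using False insert by simp
    then have 0: "0 < Max A" "Max A < b" "f (Max A) = f b" using insert by auto
    have "\<exists>z>Max A. z < b \<and> f' z = 0"
    proof (rule Rolle[OF 0(2,3), THEN exE])
      show "continuous_on {Max A..b} f"
        using df 0(1) by (intro continuous_at_imp_continuous_on ballI)
          (meson DERIV_isCont atLeastAtMost_iff less_le_trans)
      show "f differentiable (at x)" if "Max A < x" "x < b" for x
        using df 0(1) that by (meson order.strict_trans real_differentiable_def)
    next
      fix z assume z: "Max A < z \<and> z < b \<and> (f has_real_derivative 0) (at z)"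
      then have "f' z = 0" using df 0(1) by (meson DERIV_unique order.strict_trans)
      with z show ?thesis by blast
    qed
    then obtain z where z: "Max A < z" "z < b" "f' z = 0" by blast
    have "z \<notin> B" using B z by auto
    moreover have "Max (insert b A) = b"
      using insert False 0 by (simp add: max_absorb1)
    moreover have "b \<notin> A" using insert by auto
    ultimately show ?thesis
      using B z insert.hyps 0 by (intro exI[of _ "insert z B"]) (auto simp: card_insert_if)
  qed (auto intro!: exI[of _ "{}"])
qed auto

lemma higher_deriv_pos_zero:
  assumes "higher_deriv_pos k f g" "A \<subseteq> {0<..}" "\<forall>x\<in>A. f x = 0" "card A = Suc k"
  shows "\<exists>x>0. g x = 0"
  using assms
proof (induction k arbitrary: f A)
  case 0
  then show ?case by (auto simp: card_1_singleton_iff)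
next
  case (Suc k)
  then obtain f' where f': "\<forall>x>0. (f has_real_derivative f' x) (at x)" "higher_deriv_pos k f' g"
    by auto
  have "finite A" "A \<noteq> {}" using Suc.prems card_gt_0_iff[of A] by auto
  from Rolle_zeros[OF this Suc.prems(2,3) f'(1)] obtain B where
    "B \<subseteq> {0<..<Max A}" "\<forall>x\<in>B. f' x = 0" "Suc (card B) = card A" by blast
  then show ?case using Suc.prems(4) by (intro Suc.IH[OF f'(2), of B]) auto
qed

section \<open>Divided differences\<close>

text \<open>For distinct entries this is the leading coefficient of the Lagrange interpolation
  polynomial, that is, the classical divided difference in its explicit symmetric form.\<close>

definition divided_difference :: "(real \<Rightarrow> real) \<Rightarrow> real ^ 'n \<Rightarrow> real" where
  "divided_difference f x = (\<Sum>i\<in>UNIV. f (x $ i) / (\<Prod>j\<in>UNIV-{i}. x $ i - x $ j))"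

lemma divided_difference_mean_value:
  fixes x :: "real ^ 'n"
  assumes f: "higher_deriv_pos (CARD('n) - 1) f g"
    and pos: "\<And>i. x $ i > 0" and inj: "inj (\<lambda>i. x $ i)"
  shows "\<exists>z>0. g z = fact (CARD('n) - 1) * divided_difference f x"
proof -
  define N where "N = CARD('n) - 1"
  \<comment> \<open>\<open>L i\<close> is the Lagrange basis polynomial without its denominator,
    hence monic of degree \<open>N\<close>. With the denominators moved into \<open>p\<close>, the
    top coefficient of \<open>p\<close> is exactly the divided difference.\<close>
  define L where "L i = (\<Prod>j\<in>UNIV-{i}. [:- (x $ j), 1:])" for i
  define p where "p = (\<Sum>i\<in>UNIV. smult (f (x $ i) / (\<Prod>j\<in>UNIV-{i}. x $ i - x $ j)) (L i))"
  have neq: "x $ i \<noteq> x $ j" if "i \<noteq> j" for i j using inj that by (auto dest: injD)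
  have degL: "degree (L i) = N" for i
    unfolding L_def N_def by (subst degree_prod_eq_sum_degree) (auto simp: card_Diff_singleton)
  have "coeff (L i) N = 1" for i
    using lead_coeff_prod[of "\<lambda>j. [:- (x $ j), 1:]" "UNIV-{i}"]
    unfolding L_def[symmetric] degL by simp
  then have coeffp: "coeff p N = divided_difference f x"
    unfolding p_def divided_difference_def by (simp add: coeff_sum)
  have degp: "degree p \<le> N"
    unfolding p_def by (intro degree_sum_le) (auto intro: order.trans[OF degree_smult_le] simp: degL)
  have evalL: "poly (L i) (x $ k) = (if i = k then (\<Prod>j\<in>UNIV-{i}. x $ i - x $ j) else 0)" for i k
    unfolding L_def by (auto simp: poly_prod intro!: prod.cong)
  have evalp: "poly p (x $ k) = f (x $ k)" for k
  proof -
    have "poly p (x $ k) = (\<Sum>i\<in>UNIV. if i = k then f (x $ k) else 0)"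
      unfolding p_def poly_sum
      by (rule sum.cong) (auto simp: evalL neq)
    then show ?thesis by simp
  qed
  \<comment> \<open>The interpolation error vanishes at all \<open>Suc N\<close> entries, so its
    derivative of order \<open>N\<close> has a positive zero.\<close>
  have "higher_deriv_pos N (\<lambda>t. f t + (- 1) * poly p t) (\<lambda>t. g t + (- 1) * (fact N * coeff p N))"
    using f unfolding N_def[symmetric]
    by (intro higher_deriv_pos_add higher_deriv_pos_cmult higher_deriv_pos_poly degp)
  moreover have "card (range (\<lambda>i. x $ i)) = Suc N"
    unfolding N_def using inj by (simp add: card_image)
  ultimately have "\<exists>z>0. g z + (- 1) * (fact N * coeff p N) = 0"
    using pos evalp by (intro higher_deriv_pos_zero[where A = "range (\<lambda>i. x $ i)"]) auto
  then show ?thesis unfolding N_def[symmetric] coeffp by auto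
qed

lemma divided_difference_power_ln_sign:
  fixes x :: "real ^ 'n"
  assumes q: "2 \<le> q" "q \<le> CARD('n)"
    and pos: "\<And>i. x $ i > 0" and inj: "inj (\<lambda>i. x $ i)"
  shows "(- 1) ^ q * divided_difference (\<lambda>t. t ^ (CARD('n) - q) * (ln t + 1)) x > 0"
proof -
  define f :: "real \<Rightarrow> real" where "f t = t ^ (CARD('n) - q) * (ln t + 1)" for t
  \<comment> \<open>Of the \<open>CARD('n) - 1\<close> derivatives, \<open>CARD('n) - q\<close>
    remove the power, one turns the logarithm into \<open>inverse\<close>, and \<open>q - 2\<close>
    determine the sign. This split requires \<open>2 \<le> q\<close>.\<close>
  have "CARD('n) - 1 = Suc ((CARD('n) - q) + (q - 2))" using q by simp
  then obtain g where g: "higher_deriv_pos (CARD('n) - 1) f g" "\<forall>x>0. (- 1) ^ (q - 2) * g x > 0"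
    unfolding f_def using higher_deriv_pos_power_ln[of "CARD('n) - q" "q - 2"] by metis
  obtain z where "z > 0" "g z = fact (CARD('n) - 1) * divided_difference f x"
    using divided_difference_mean_value[OF g(1) pos inj] by blast
  then have "(- 1) ^ (q - 2) * (fact (CARD('n) - 1) * divided_difference f x) > 0"
    using g(2) by metis
  then have "fact (CARD('n) - 1) * ((- 1) ^ (q - 2) * divided_difference f x) > 0"
    by (simp add: mult_ac)
  then have "(- 1) ^ (q - 2) * divided_difference f x > 0"
    by (rule zero_less_mult_pos) simp
  moreover have "(- 1 :: real) ^ (q - 2) = (- 1) ^ q"
    using q by (simp add: minus_one_power_iff)
  ultimately show ?thesis unfolding f_def by simp
qed

section \<open>Smoothness from algebras closed under differentiation\<close>

inductive_set function_algebra :: "('a \<Rightarrow> real) set \<Rightarrow> ('a \<Rightarrow> real) set" for G where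
  const: "(\<lambda>_. c) \<in> function_algebra G"
| gen: "h \<in> G \<Longrightarrow> h \<in> function_algebra G"
| add: "h \<in> function_algebra G \<Longrightarrow> k \<in> function_algebra G \<Longrightarrow> (\<lambda>y. h y + k y) \<in> function_algebra G"
| mult: "h \<in> function_algebra G \<Longrightarrow> k \<in> function_algebra G \<Longrightarrow> (\<lambda>y. h y * k y) \<in> function_algebra G"

lemma function_algebra_uminus:
  assumes "h \<in> function_algebra G"
  shows "(\<lambda>y. - h y) \<in> function_algebra G"
  using function_algebra.mult[OF function_algebra.const[of "- 1"] assms] by simp

lemma function_algebra_diff:
  assumes "h \<in> function_algebra G" "k \<in> function_algebra G"
  shows "(\<lambda>y. h y - k y) \<in> function_algebra G"
  using function_algebra.add[OF assms(1) function_algebra_uminus[OF assms(2)]] by simp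

lemma function_algebra_sum:
  assumes "\<And>i. i \<in> I \<Longrightarrow> h i \<in> function_algebra G"
  shows "(\<lambda>y. \<Sum>i\<in>I. h i y) \<in> function_algebra G"
  using assms
  by (induction I rule: infinite_finite_induct) (auto intro: function_algebra.intros)

lemma function_algebra_prod:
  assumes "\<And>i. i \<in> I \<Longrightarrow> h i \<in> function_algebra G"
  shows "(\<lambda>y. \<Prod>i\<in>I. h i y) \<in> function_algebra G"
  using assms
  by (induction I rule: infinite_finite_induct) (auto intro: function_algebra.intros)

lemma function_algebra_power:
  assumes "h \<in> function_algebra G"
  shows "(\<lambda>y. h y ^ n) \<in> function_algebra G"
  using assms by (induction n) (auto intro: function_algebra.intros)

text \<open>The direction \<open>v\<close> is fixed before the algebra element is chosen, as in the
  recursion of \<open>Ck_on\<close>. Agreement is asked on \<open>U\<close> only, since nothing is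
  known about the derivative outside.\<close>

definition deriv_closed :: "'a::real_normed_vector set \<Rightarrow> ('a \<Rightarrow> real) set \<Rightarrow> ('a \<Rightarrow> real) \<Rightarrow> bool" where
  "deriv_closed U G h \<longleftrightarrow> (\<exists>D. (\<forall>y\<in>U. (h has_derivative D y) (at y)) \<and>
     (\<forall>v. \<exists>k\<in>function_algebra G. \<forall>y\<in>U. D y v = k y))"

text \<open>The sum and product rules carry closure from the generators to the whole
  algebra.\<close>

lemma deriv_closed_function_algebra:
  assumes G: "\<And>h. h \<in> G \<Longrightarrow> deriv_closed U G h" and "h \<in> function_algebra G"
  shows "deriv_closed U G h"
  using assms(2)
proof induction
  case (const c)
  show ?case unfolding deriv_closed_def
    by (intro exI[of _ "\<lambda>_ _. 0"]) (auto intro: function_algebra.const)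
next
  case (gen h)
  then show ?case by (rule G)
next
  case (add h k)
  then obtain D E where DE: "\<forall>y\<in>U. (h has_derivative D y) (at y)"
    "\<forall>v. \<exists>k\<in>function_algebra G. \<forall>y\<in>U. D y v = k y"
    "\<forall>y\<in>U. (k has_derivative E y) (at y)"
    "\<forall>v. \<exists>k\<in>function_algebra G. \<forall>y\<in>U. E y v = k y"
    unfolding deriv_closed_def by blast
  have "\<exists>l\<in>function_algebra G. \<forall>y\<in>U. D y v + E y v = l y" for v
  proof -
    obtain d e where "d \<in> function_algebra G" "\<forall>y\<in>U. D y v = d y"
      "e \<in> function_algebra G" "\<forall>y\<in>U. E y v = e y" using DE by metis
    then show ?thesis
      by (intro bexI[of _ "\<lambda>y. d y + e y"]) (auto intro: function_algebra.intros)
  qed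
  then show ?case unfolding deriv_closed_def using DE
    by (intro exI[of _ "\<lambda>y v. D y v + E y v"]) (auto intro: has_derivative_add)
next
  case (mult h k)
  then obtain D E where DE: "\<forall>y\<in>U. (h has_derivative D y) (at y)"
    "\<forall>v. \<exists>k\<in>function_algebra G. \<forall>y\<in>U. D y v = k y"
    "\<forall>y\<in>U. (k has_derivative E y) (at y)"
    "\<forall>v. \<exists>k\<in>function_algebra G. \<forall>y\<in>U. E y v = k y"
    unfolding deriv_closed_def by blast
  have "\<exists>l\<in>function_algebra G. \<forall>y\<in>U. h y * E y v + D y v * k y = l y" for v
  proof -
    obtain d e where "d \<in> function_algebra G" "\<forall>y\<in>U. D y v = d y"
      "e \<in> function_algebra G" "\<forall>y\<in>U. E y v = e y" using DE by metis
    then show ?thesis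
      using mult.hyps
      by (intro bexI[of _ "\<lambda>y. h y * e y + d y * k y"]) (auto intro: function_algebra.intros)
  qed
  then show ?case unfolding deriv_closed_def using DE
    by (intro exI[of _ "\<lambda>y v. h y * E y v + D y v * k y"]) (auto intro: has_derivative_mult)
qed

lemma has_derivative_vec_nth_iff:
  fixes f :: "'a::real_normed_vector \<Rightarrow> real ^ 'n"
  shows "(f has_derivative f') (at y) \<longleftrightarrow>
    (\<forall>i. ((\<lambda>y. f y $ i) has_derivative (\<lambda>v. f' v $ i)) (at y))"
  by (subst has_derivative_componentwise_within) (auto simp: Basis_vec_def inner_axis)

text \<open>Each directional derivative of \<open>F\<close> again has components that agree on
  \<open>U\<close> with elements of the algebra, so the induction on \<open>k\<close> runs with
  \<open>F\<close> arbitrary. Openness of \<open>U\<close> lets derivatives pass between functions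
  that agree only there.\<close>

lemma Ck_on_function_algebra:
  fixes F :: "'a::real_normed_vector \<Rightarrow> real ^ 'n"
  assumes G: "\<And>h. h \<in> G \<Longrightarrow> deriv_closed U G h" and "open U"
    and "\<And>i. \<exists>h\<in>function_algebra G. \<forall>y\<in>U. F y $ i = h y"
  shows "Ck_on k F U"
  using assms(3)
proof (induction k arbitrary: F)
  case (0 F)
  then obtain h where h: "\<And>i. h i \<in> function_algebra G" "\<And>i y. y \<in> U \<Longrightarrow> F y $ i = h i y" by metis
  have "continuous_on U (h i)" for i
    using deriv_closed_function_algebra[OF G h(1)[of i]] unfolding deriv_closed_def
    by (meson continuous_at_imp_continuous_on has_derivative_continuous)
  then have "continuous_on U (\<lambda>y. F y $ i)" for i
    using h(2) by (metis (no_types, lifting) continuous_on_cong)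
  then have "continuous_on U (\<lambda>y. \<chi> i. F y $ i)"
    by (rule continuous_on_vec_lambda)
  then show ?case by simp
next
  case (Suc k F)
  then obtain h where h: "\<And>i. h i \<in> function_algebra G" "\<And>i y. y \<in> U \<Longrightarrow> F y $ i = h i y" by metis
  have "\<exists>D. (\<forall>y\<in>U. (h i has_derivative D y) (at y)) \<and>
     (\<forall>v. \<exists>k\<in>function_algebra G. \<forall>y\<in>U. D y v = k y)" for i
    using deriv_closed_function_algebra[OF G h(1)[of i]] unfolding deriv_closed_def .
  then obtain D where D: "\<And>i y. y \<in> U \<Longrightarrow> (h i has_derivative D i y) (at y)"
     "\<And>i v. \<exists>k\<in>function_algebra G. \<forall>y\<in>U. D i y v = k y"
    by metis
  have der: "(F has_derivative (\<lambda>v. \<chi> i. D i y v)) (at y)" if "y \<in> U" for y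
    unfolding has_derivative_vec_nth_iff
  proof
    fix i
    show "((\<lambda>y. F y $ i) has_derivative (\<lambda>v. (\<chi> i. D i y v) $ i)) (at y)"
      using has_derivative_transform_within_open[OF D(1)[OF that] \<open>open U\<close> that] h(2) by simp
  qed
  then have "Ck_on k (\<lambda>y. frechet_derivative F (at y) v) U" for v
  proof (intro Suc.IH)
    fix i
    have "frechet_derivative F (at y) v $ i = D i y v" if "y \<in> U" for y
      using frechet_derivative_at[OF der[OF that]] by (metis vec_lambda_beta)
    then show "\<exists>h\<in>function_algebra G. \<forall>y\<in>U. frechet_derivative F (at y) v $ i = h y"
      using D(2) by metis
  qed
  then show ?case using der by (auto simp: differentiable_def)
qed

section \<open>Vieta's formula and the derivative of the symmetric map\<close>

text \<open>Expand the product over the set \<open>K\<close> of factors that contribute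
  \<open>- x $ i\<close>, then group these sets by cardinality.\<close>

lemma prod_diff_esym:
  fixes x :: "real ^ 'n"
  shows "(\<Prod>i\<in>UNIV. t - x $ i) = (\<Sum>k\<le>CARD('n). (- 1) ^ k * esym k x * t ^ (CARD('n) - k))"
proof -
  have "(\<Prod>i\<in>UNIV. t - x $ i) = (\<Prod>i\<in>UNIV. - x $ i + t)" by (simp add: algebra_simps)
  also have "\<dots> = (\<Sum>K\<in>UNIV. (\<Prod>i\<in>K. - x $ i) * t ^ (CARD('n) - card K))"
    by (subst prod_add) (auto simp: card_Diff_subset)
  also have "\<dots> = (\<Sum>k\<le>CARD('n). \<Sum>K | K \<in> UNIV \<and> card K = k. (\<Prod>i\<in>K. - x $ i) * t ^ (CARD('n) - card K))"
    by (rule sum.group[symmetric]) (auto intro: card_mono)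
  also have "\<dots> = (\<Sum>k\<le>CARD('n). (- 1) ^ k * esym k x * t ^ (CARD('n) - k))"
    unfolding esym_def
    by (rule sum.cong) (auto simp: sum_distrib_left sum_distrib_right prod_uminus intro!: sum.cong)
  finally show ?thesis .
qed

lemma esym_0 [simp]: "esym 0 x = 1"
proof -
  have "{K :: 'a set. card K = 0} = {{}}" by auto
  then show ?thesis unfolding esym_def by simp
qed

text \<open>The term \<open>k = 0\<close> is no coordinate of the target and is split off. The rest
  is linear in \<open>esym_map idx x\<close>, ready to be differentiated in \<open>x\<close> for
  fixed \<open>t\<close>.\<close>

lemma prod_diff_esym_map:
  fixes x :: "real ^ 'n"
  assumes "bij_betw idx UNIV {1..CARD('n)}"
  shows "(\<Prod>i\<in>UNIV. t - x $ i) =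
    t ^ CARD('n) + (\<Sum>j\<in>UNIV. (- 1) ^ idx j * t ^ (CARD('n) - idx j) * esym_map idx x $ j)"
proof -
  have "{..CARD('n)} = insert 0 {1..CARD('n)}" by auto
  then have "(\<Prod>i\<in>UNIV. t - x $ i) =
      t ^ CARD('n) + (\<Sum>k\<in>{1..CARD('n)}. (- 1) ^ k * esym k x * t ^ (CARD('n) - k))"
    unfolding prod_diff_esym by simp
  also have "(\<Sum>k\<in>{1..CARD('n)}. (- 1) ^ k * esym k x * t ^ (CARD('n) - k)) =
      (\<Sum>j\<in>UNIV. (- 1) ^ idx j * esym (idx j) x * t ^ (CARD('n) - idx j))"
    by (rule sum.reindex_bij_betw[OF assms, symmetric])
  finally show ?thesis unfolding esym_map_def by (simp add: mult_ac)
qed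

text \<open>The components are polynomials in the coordinate functions, whose directional
  derivatives are constants.\<close>

lemma Ck_on_esym_map: "open U \<Longrightarrow> Ck_on k (esym_map idx) U"
proof (rule Ck_on_function_algebra[where G = "range (\<lambda>i x. x $ i)"])
  fix h :: "real ^ 'a \<Rightarrow> real" assume "h \<in> range (\<lambda>i x. x $ i)"
  then obtain i where h: "h = (\<lambda>x. x $ i)" by auto
  show "deriv_closed U (range (\<lambda>i x. x $ i)) h"
    unfolding deriv_closed_def h
    by (intro exI[of _ "\<lambda>_ v. v $ i"] conjI ballI allI
        bounded_linear_imp_has_derivative bounded_linear_vec_nth)
      (auto intro: function_algebra.const)
next
  fix i
  show "\<exists>h\<in>function_algebra (range (\<lambda>i x. x $ i)). \<forall>y\<in>U. esym_map idx y $ i = h y"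
    unfolding esym_map_def esym_def
    by (intro bexI[of _ "\<lambda>x. \<Sum>K | card K = idx i. \<Prod>i\<in>K. x $ i"]
        function_algebra_sum function_algebra_prod function_algebra.gen) auto
qed

lemma esym_map_differentiable: "esym_map idx differentiable (at x)"
  using Ck_on_esym_map[of UNIV "Suc 0" idx] by simp

text \<open>Both sides of Vieta's formula are differentiated in \<open>x\<close>. At
  \<open>t = x $ i\<close> every summand of the product rule with \<open>k \<noteq> i\<close>
  contains the factor \<open>t - x $ i = 0\<close>. For distinct entries the result recovers
  \<open>w\<close> from \<open>D w\<close>, so it inverts the Jacobian.\<close>

lemma esym_map_derivative:
  fixes x :: "real ^ 'n"
  assumes idx: "bij_betw idx UNIV {1..CARD('n)}"
    and D: "(esym_map idx has_derivative D) (at x)"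
  shows "w $ i * (\<Prod>j\<in>UNIV-{i}. x $ i - x $ j) =
    - (\<Sum>j\<in>UNIV. (- 1) ^ idx j * (x $ i) ^ (CARD('n) - idx j) * D w $ j)"
proof -
  \<comment> \<open>\<open>t\<close> is frozen at the base point: it does not vary when the identity
    is differentiated.\<close>
  define t where "t = x $ i"
  have "((\<lambda>x. \<Prod>j\<in>UNIV. t - x $ j) has_derivative
      (\<lambda>w. \<Sum>k\<in>UNIV. (0 - w $ k) * (\<Prod>j\<in>UNIV-{k}. t - x $ j))) (at x)"
    by (intro has_derivative_prod has_derivative_diff has_derivative_const
        bounded_linear_imp_has_derivative bounded_linear_vec_nth)
  moreover have "((\<lambda>x. \<Prod>j\<in>UNIV. t - x $ j) has_derivative
      (\<lambda>w. 0 + (\<Sum>j\<in>UNIV. (- 1) ^ idx j * t ^ (CARD('n) - idx j) * D w $ j))) (at x)"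
    unfolding prod_diff_esym_map[OF idx]
    using D unfolding has_derivative_vec_nth_iff
    by (intro has_derivative_add has_derivative_sum has_derivative_mult_right has_derivative_const) auto
  ultimately have "(\<Sum>k\<in>UNIV. (0 - w $ k) * (\<Prod>j\<in>UNIV-{k}. t - x $ j)) =
      0 + (\<Sum>j\<in>UNIV. (- 1) ^ idx j * t ^ (CARD('n) - idx j) * D w $ j)"
    by (blast dest: has_derivative_unique fun_cong)
  moreover have "(\<Sum>k\<in>UNIV. (0 - w $ k) * (\<Prod>j\<in>UNIV-{k}. t - x $ j)) =
      (\<Sum>k\<in>{i}. (0 - w $ k) * (\<Prod>j\<in>UNIV-{k}. t - x $ j))"
    by (rule sum.mono_neutral_right) (auto simp: t_def)
  ultimately show ?thesis unfolding t_def by simp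
qed

section \<open>Derivative and smoothness of a right inverse\<close>

text \<open>The chain rule gives \<open>D (g' v) = v\<close>, so the inverted Jacobian applies with
  \<open>w = g' v\<close>. The reciprocal is kept as a product of \<open>inverse\<close> factors to
  match the generators in the smoothness proof.\<close>

lemma esym_map_right_inverse_derivative:
  fixes g :: "real ^ 'n \<Rightarrow> real ^ 'n"
  assumes idx: "bij_betw idx UNIV {1..CARD('n)}"
    and V: "open V" "y \<in> V" "\<And>z. z \<in> V \<Longrightarrow> esym_map idx (g z) = z"
    and g: "(g has_derivative g') (at y)" and inj: "inj (\<lambda>i. g y $ i)"
  shows "g' v $ i = - (\<Sum>j\<in>UNIV. (- 1) ^ idx j * (g y $ i) ^ (CARD('n) - idx j) * v $ j) *
    (\<Prod>k\<in>UNIV-{i}. inverse (g y $ i - g y $ k))"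
proof -
  obtain D where D: "(esym_map idx has_derivative D) (at (g y))"
    using esym_map_differentiable unfolding differentiable_def by blast
  have "(esym_map idx \<circ> g has_derivative D \<circ> g') (at y)"
    using diff_chain_at[OF g D] .
  moreover have "(esym_map idx \<circ> g has_derivative (\<lambda>v. v)) (at y)"
    by (rule has_derivative_transform_within_open[OF has_derivative_ident V(1,2)]) (simp add: V(3))
  ultimately have "D \<circ> g' = (\<lambda>v. v)"
    by (rule has_derivative_unique)
  then have Dg: "D (g' v) = v"
    by (simp add: fun_eq_iff)
  define P where "P = (\<Prod>k\<in>UNIV-{i}. g y $ i - g y $ k)"
  have "P \<noteq> 0"
    unfolding P_def using inj by (auto dest: injD)
  moreover have "(\<Prod>k\<in>UNIV-{i}. inverse (g y $ i - g y $ k)) = inverse P"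
    unfolding P_def by (rule prod_inversef[unfolded comp_def])
  moreover have "g' v $ i * P = - (\<Sum>j\<in>UNIV. (- 1) ^ idx j * (g y $ i) ^ (CARD('n) - idx j) * v $ j)"
    using esym_map_derivative[OF idx D, of "g' v" i] unfolding Dg P_def .
  ultimately show ?thesis
    by (metis divide_inverse nonzero_eq_divide_eq)
qed

lemma smooth_on_esym_map_right_inverse:
  fixes g :: "real ^ 'n \<Rightarrow> real ^ 'n"
  assumes idx: "bij_betw idx UNIV {1..CARD('n)}"
    and V: "open V" "\<And>z. z \<in> V \<Longrightarrow> esym_map idx (g z) = z"
    and g: "\<And>y. y \<in> V \<Longrightarrow> (g has_derivative g' y) (at y)"
    and inj: "\<And>y. y \<in> V \<Longrightarrow> inj (\<lambda>i. g y $ i)"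
  shows "smooth_on g V"
proof -
  \<comment> \<open>The reciprocal differences must be generators because they occur in the
    derivative of \<open>g\<close>. Their own derivatives only bring in further factors of the same
    kind and the functions \<open>d i v\<close>.\<close>
  define G where "G = {\<lambda>y. g y $ i | i. True} \<union> {\<lambda>y. inverse (g y $ i - g y $ k) | i k. i \<noteq> k}"
  define d where "d i v y = - (\<Sum>j\<in>UNIV. (- 1) ^ idx j * (g y $ i) ^ (CARD('n) - idx j) * v $ j) *
    (\<Prod>k\<in>UNIV-{i}. inverse (g y $ i - g y $ k))" for i v y
  have coord: "(\<lambda>y. g y $ i) \<in> function_algebra G" for i
    by (rule function_algebra.gen) (auto simp: G_def)
  have inv: "(\<lambda>y. inverse (g y $ i - g y $ k)) \<in> function_algebra G" if "i \<noteq> k" for i k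
    by (rule function_algebra.gen) (use that in \<open>auto simp: G_def\<close>)
  have d: "d i v \<in> function_algebra G" for i v
    unfolding d_def
    by (intro function_algebra.mult function_algebra.const function_algebra_uminus
        function_algebra_sum function_algebra_prod function_algebra_power coord inv) auto
  have der: "((\<lambda>y. g y $ i) has_derivative (\<lambda>v. d i v y)) (at y)" if "y \<in> V" for i y
    using g[OF that] esym_map_right_inverse_derivative[OF idx V(1) that V(2) g[OF that] inj[OF that]]
    unfolding has_derivative_vec_nth_iff d_def by simp
  have G: "deriv_closed V G h" if h: "h \<in> G" for h
  proof -
    consider i where "h = (\<lambda>y. g y $ i)"
      | i k where "i \<noteq> k" "h = (\<lambda>y. inverse (g y $ i - g y $ k))"
      using h unfolding G_def by auto
    then show ?thesis
    proof cases
      case 1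
      then show ?thesis unfolding deriv_closed_def
        using der d by (intro exI[of _ "\<lambda>y v. d i v y"] conjI allI bexI[of _ "d i v" for v]) auto
    next
      case 2
      let ?w = "\<lambda>y. g y $ i - g y $ k"
      have "?w y \<noteq> 0" if "y \<in> V" for y using inj[OF that] 2(1) by (auto dest: injD)
      then have "(h has_derivative (\<lambda>v. - (inverse (?w y) * (d i v y - d k v y) * inverse (?w y)))) (at y)"
        if "y \<in> V" for y
        unfolding 2 using that by (intro Deriv.has_derivative_inverse has_derivative_diff der) auto
      moreover have w: "(\<lambda>y. - (inverse (?w y) * (d i v y - d k v y) * inverse (?w y))) \<in> function_algebra G" for v
        by (intro function_algebra.mult function_algebra_uminus function_algebra_diff d inv 2)
      ultimately show ?thesis unfolding deriv_closed_def
        by (intro exI[of _ "\<lambda>y v. - (inverse (?w y) * (d i v y - d k v y) * inverse (?w y))"]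
            conjI allI bexI[OF _ w]) auto
    qed
  qed
  show ?thesis
    unfolding smooth_on_def
    by (intro allI Ck_on_function_algebra[OF G V(1)] bexI[OF _ coord]) auto
qed

section \<open>Existence of the local diffeomorphism\<close>

lemma open_distinct: "open {z :: real ^ 'n. inj (\<lambda>i. z $ i)}"
proof -
  have "{z :: real ^ 'n. inj (\<lambda>i. z $ i)} = (\<Inter>(i, k)\<in>{(i, k). i \<noteq> k}. {z. z $ i \<noteq> z $ k})"
    by (auto simp: inj_def)
  moreover have "open \<dots>"
    by (intro open_INT) (auto intro!: open_Collect_neq continuous_intros)
  ultimately show ?thesis by simp
qed

text \<open>The inverse function theorem yields a differentiable local inverse, and the preceding
  results upgrade it to a smooth one. Working inside \<open>W\<close> ensures that the values of the
  inverse have distinct entries.\<close>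

lemma local_diffeo_at_esym_map:
  fixes x :: "real ^ 'n"
  assumes idx: "bij_betw idx UNIV {1..CARD('n)}" and inj: "inj (\<lambda>i. x $ i)"
  shows "\<exists>U V g. local_diffeo_at (esym_map idx) x U V g"
proof -
  let ?f = "esym_map idx :: real ^ 'n \<Rightarrow> real ^ 'n"
  define W where "W = {z :: real ^ 'n. inj (\<lambda>i. z $ i)}"
  define F where "F z = Blinfun (frechet_derivative ?f (at z))" for z
  have der: "(?f has_derivative frechet_derivative ?f (at z)) (at z)" for z
    using esym_map_differentiable frechet_derivative_works by blast
  then have F: "blinfun_apply (F z) = frechet_derivative ?f (at z)" for z
    unfolding F_def by (intro bounded_linear_Blinfun_apply has_derivative_bounded_linear)
  \<comment> \<open>In finite dimension, continuity in operator norm reduces to continuity in each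
    direction, which is part of \<open>Ck_on (Suc 0)\<close>.\<close>
  have contF: "continuous_on W F"
    using Ck_on_esym_map[of UNIV "Suc 0" idx]
    by (intro continuous_on_blinfun_componentwise) (auto simp: F intro: continuous_on_subset)
  have lin: "linear (F x)" by (rule bounded_linear.linear[OF blinfun.bounded_linear_right])
  \<comment> \<open>A trivial kernel takes the place of a nonvanishing Jacobian determinant.\<close>
  have "inj (F x)"
    unfolding linear_injective_0[OF lin]
  proof (intro allI impI)
    fix w assume "F x w = 0"
    then have "w $ i * (\<Prod>j\<in>UNIV-{i}. x $ i - x $ j) = 0" for i
      using esym_map_derivative[OF idx der, of w i x] by (simp add: F)
    moreover have "(\<Prod>j\<in>UNIV-{i}. x $ i - x $ j) \<noteq> 0" for i
      using inj by (auto dest: injD)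
    ultimately show "w = 0" by (simp add: vec_eq_iff)
  qed
  from linear_injective_left_inverse[OF lin this]
  obtain h where h: "linear h" "h \<circ> F x = id" by blast
  have h_inv: "Blinfun h o\<^sub>L F x = id_blinfun"
    using h by (intro blinfun_eqI)
      (simp add: bounded_linear_Blinfun_apply linear_conv_bounded_linear pointfree_idE)
  have W: "open W" "x \<in> W"
    using open_distinct inj unfolding W_def by auto
  have derF: "(?f has_derivative blinfun_apply (F z)) (at z)" for z
    unfolding F by (rule der)
  obtain U V g g' where UV: "open U" "U \<subseteq> W" "x \<in> U" "open V"
      "homeomorphism U V ?f g" "\<And>y. y \<in> V \<Longrightarrow> (g has_derivative (g' y)) (at y)"
    using inverse_function_theorem[OF W(1) derF contF W(2) h_inv] by metis
  have "smooth_on g V"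
  proof (rule smooth_on_esym_map_right_inverse[OF idx UV(4) _ UV(6)])
    show "?f (g z) = z" if "z \<in> V" for z
      using UV(5) that by (simp add: homeomorphism_apply2)
    show "inj (\<lambda>i. g y $ i)" if "y \<in> V" for y
      using UV(2,5) that unfolding W_def homeomorphism_def by blast
  qed
  moreover have "smooth_on ?f U"
    unfolding smooth_on_def using UV(1) Ck_on_esym_map by blast
  ultimately show ?thesis
    unfolding local_diffeo_at_def using UV by blast
qed

section \<open>The partial derivatives of the entropy\<close>

lemma entropy_derivative_along_curve:
  fixes c :: "real \<Rightarrow> real ^ 'n"
  assumes c: "\<And>i. ((\<lambda>t. c t $ i) has_real_derivative c' i) (at s)"
    and pos: "\<And>i. c s $ i > 0"
  shows "((\<lambda>t. entropy (c t)) has_real_derivative - (\<Sum>i\<in>UNIV. c' i * (ln (c s $ i) + 1))) (at s)"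
proof -
  have "((\<lambda>t. c t $ i * ln (c t $ i)) has_real_derivative c' i * (ln (c s $ i) + 1)) (at s)" for i
    using DERIV_mult[OF c[of i] DERIV_chain2[OF DERIV_ln[OF pos[of i]] c[of i]]] pos[of i]
    by (simp add: field_simps)
  then show ?thesis
    unfolding entropy_def by (intro DERIV_minus DERIV_sum)
qed

theorem theorem1:
  fixes x :: "real ^ 'n" and idx :: "'n \<Rightarrow> nat"
  assumes "CARD('n) \<ge> 2"
    and "bij_betw idx UNIV {1..CARD('n)}"
    and "\<And>i. x $ i > 0"
    and "inj (\<lambda>i. x $ i)"
  shows "(\<exists>U V g. local_diffeo_at (esym_map idx) x U V g) \<and>
    (\<forall>U V g. local_diffeo_at (esym_map idx) x U V g \<longrightarrow>
      (\<forall>q\<in>{2..CARD('n)}. \<exists>D>0.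
        ((\<lambda>t. entropy (g (\<chi> j. if idx j = q then t else esym (idx j) x)))
          has_real_derivative D) (at (esym q x))))"
proof (intro conjI allI impI ballI)
  show "\<exists>U V g. local_diffeo_at (esym_map idx) x U V g"
    by (rule local_diffeo_at_esym_map[OF assms(2,4)])
next
  fix U V :: "(real ^ 'n) set" and g :: "real ^ 'n \<Rightarrow> real ^ 'n" and q
  assume loc: "local_diffeo_at (esym_map idx) x U V g" and q: "q \<in> {2..CARD('n)}"
  \<comment> \<open>\<open>\<gamma>\<close> is the coordinate line of \<open>s_q\<close> through the
    image point \<open>y\<close>, with constant velocity \<open>v\<close>.\<close>
  define \<gamma> :: "real \<Rightarrow> real ^ 'n" where "\<gamma> t = (\<chi> j. if idx j = q then t else esym (idx j) x)" for t
  define v :: "real ^ 'n" where "v = (\<chi> j. if idx j = q then 1 else 0)"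
  define y where "y = esym_map idx x"
  have hom: "homeomorphism U V (esym_map idx) g" and "x \<in> U" "open V" and sm: "smooth_on g V"
    using loc unfolding local_diffeo_at_def by auto
  have inv: "esym_map idx (g z) = z" if "z \<in> V" for z
    using hom that by (simp add: homeomorphism_apply2)
  have "y \<in> V" using hom \<open>x \<in> U\<close> unfolding y_def homeomorphism_def by blast
  have gy: "g y = x" unfolding y_def using hom \<open>x \<in> U\<close> by (simp add: homeomorphism_apply1)
  have \<gamma>q: "\<gamma> (esym q x) = y"
    unfolding \<gamma>_def y_def esym_map_def by (auto simp: vec_eq_iff)
  obtain g' where g': "(g has_derivative g') (at y)"
  proof -
    have "Ck_on (Suc 0) g V" using sm unfolding smooth_on_def by blast
    then show ?thesis using \<open>y \<in> V\<close> that unfolding Ck_on.simps differentiable_def by blast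
  qed
  \<comment> \<open>Exactly one coordinate \<open>j0\<close> carries \<open>s_q\<close>, so sums
    against \<open>v\<close> collapse to a single term.\<close>
  have "q \<in> range idx" using bij_betw_imp_surj_on[OF assms(2)] q by simp
  then obtain j0 where "idx j0 = q" by blast
  then have j0: "idx j = q \<longleftrightarrow> j = j0" for j
    using bij_betw_imp_inj_on[OF assms(2)] by (auto dest: injD)
  have "(\<gamma> has_derivative (\<lambda>h. h *\<^sub>R v)) (at (esym q x))"
    unfolding has_derivative_vec_nth_iff \<gamma>_def v_def by auto
  then have "(g \<circ> \<gamma> has_derivative g' \<circ> (\<lambda>h. h *\<^sub>R v)) (at (esym q x))"
    using g' by (intro diff_chain_at) (auto simp: \<gamma>q)
  then have der: "((\<lambda>t. g (\<gamma> t) $ i) has_real_derivative g' v $ i) (at (esym q x))" for i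
    unfolding has_derivative_vec_nth_iff has_field_derivative_def
    using linear_cmul[OF has_derivative_linear[OF g']] by (simp add: comp_def mult_commute_abs)
  have "g' v $ i = - ((- 1) ^ q * (x $ i) ^ (CARD('n) - q)) / (\<Prod>k\<in>UNIV-{i}. x $ i - x $ k)" for i
  proof -
    have "(\<Sum>j\<in>UNIV. (- 1) ^ idx j * (x $ i) ^ (CARD('n) - idx j) * v $ j) =
        (\<Sum>j\<in>UNIV. if j = j0 then (- 1) ^ q * (x $ i) ^ (CARD('n) - q) else 0)"
      by (rule sum.cong) (auto simp: v_def j0 \<open>idx j0 = q\<close>)
    then show ?thesis
      using esym_map_right_inverse_derivative[OF assms(2) \<open>open V\<close> \<open>y \<in> V\<close> inv g', of v i] assms(4)
      unfolding gy by (simp add: prod_inversef[unfolded comp_def] divide_inverse)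
  qed
  \<comment> \<open>The minus sign of the entropy cancels the one in \<open>g' v $ i\<close>, which
    leaves the factor \<open>(- 1) ^ q\<close>.\<close>
  then have "- (\<Sum>i\<in>UNIV. g' v $ i * (ln (x $ i) + 1)) =
      (- 1) ^ q * divided_difference (\<lambda>t. t ^ (CARD('n) - q) * (ln t + 1)) x"
    unfolding divided_difference_def by (simp add: sum_distrib_left sum_negf[symmetric] mult_ac)
  then have "- (\<Sum>i\<in>UNIV. g' v $ i * (ln (x $ i) + 1)) > 0"
    using divided_difference_power_ln_sign[of q x] q assms(3,4) by simp
  moreover have "((\<lambda>t. entropy (g (\<gamma> t))) has_real_derivative
      - (\<Sum>i\<in>UNIV. g' v $ i * (ln (x $ i) + 1))) (at (esym q x))"
    using entropy_derivative_along_curve[OF der] assms(3) unfolding \<gamma>q gy by blast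
  ultimately show "\<exists>D>0. ((\<lambda>t. entropy (g (\<chi> j. if idx j = q then t else esym (idx j) x)))
      has_real_derivative D) (at (esym q x))"
    unfolding \<gamma>_def by blast
qed

end
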